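(* For $r > 0$ let $D_r := \{z \in \mathbb{C} : |z| < r\}$ and let $\overline{D_r}$ be its closure. Let $C_{\overline{D_r}}$ denote the best (smallest) constant $C$ such that $\|q\|_{\overline{D_r}} \le C^n \|p\|_{\overline{D_r}}$ for every $n \ge 1$, every monic polynomial $p$ of degree $n$ with complex coefficients, and every monic factor $q$ of $p$. Then $$C_{\overline{D_r}} = \begin{cases} \dfrac{1}{r}, & 0 < r \le 1/2, \\[2ex] \dfrac{1}{r} \exp\left( \dfrac{1}{\pi} \displaystyle\int_0^{\pi - 2\arcsin\frac{1}{2r}} \log\left(2r \cos\frac{x}{2}\right) dx \right), & r > 1/2. \end{cases}$$
   Context: For a compact set $E \subset \mathbb{C}$, $\|f\|_E := \sup_{z\in E} |f(z)|$. A monic factor of a monic polynomial $p \in \mathbb{C}[z]$ is a monic polynomial $q$ such that $p = q r_0$ for some monic polynomial $r_0$. *)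

theory Defs
  imports "HOL-Analysis.Analysis" "HOL-Computational_Algebra.Polynomial"
begin

definition sup_norm_on :: "complex set \<Rightarrow> (complex \<Rightarrow> complex) \<Rightarrow> real" where
  "sup_norm_on E f = (SUP z\<in>E. norm (f z))"

definition monic_factor :: "complex poly \<Rightarrow> complex poly \<Rightarrow> bool" where
  "monic_factor q p \<longleftrightarrow> lead_coeff q = 1 \<and> (\<exists>s. lead_coeff s = 1 \<and> p = q * s)"

text \<open>Note that the exponent is the degree of \<open>p\<close>, not that of its factor \<open>q\<close>.
  The constant \<open>1\<close> is a monic factor of every monic \<open>p\<close>.\<close>

definition factor_const :: "complex set \<Rightarrow> real \<Rightarrow> bool" where
  "factor_const E C \<longleftrightarrow>
     (\<forall>n\<ge>1. \<forall>p q. lead_coeff p = 1 \<and> degree p = n \<and> monic_factor q p \<longrightarrow>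
        sup_norm_on E (poly q) \<le> C ^ n * sup_norm_on E (poly p))"

definition best_factor_const :: "complex set \<Rightarrow> real \<Rightarrow> bool" where
  "best_factor_const E C \<longleftrightarrow> factor_const E C \<and> (\<forall>C'. factor_const E C' \<longrightarrow> C \<le> C')"

end

theory Submission
  imports Defs "HOL-Complex_Analysis.Complex_Analysis"
    "HOL-Computational_Algebra.Fundamental_Theorem_Algebra"
begin

text \<open>
  Let \<open>z\<close> be a point of the circle \<open>|z| = r\<close> where \<open>|q|\<close> attains its maximum. Then \<open>|q z|\<close> is at most
  the product of \<open>max 1 |z - a|\<close> over all zeros \<open>a\<close> of \<open>p\<close>. By Jensen's formula the logarithm of this
  product is the mean of \<open>ln |p|\<close> over the circle of radius \<open>1\<close> about \<open>z\<close>, which the Bernstein-Walsh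
  inequality bounds by the mean of \<open>ln (max r |s| / r)\<close>; by Jensen's formula again (and Fubini) the
  latter is the mean of \<open>ln (max 1 |z - w|)\<close> over \<open>|w| = r\<close>, minus \<open>ln r\<close>. To avoid logarithmic
  singularities, both circles are replaced by the vertices of regular \<open>m\<close>-gons, and Jensen's formula
  by the maximum modulus principle, which yields suitable rotations of these polygons; only the last
  mean is a limit of Riemann sums. The polynomials \<open>z ^ N - r ^ N\<close> show that the bound is sharp.
\<close>

section \<open>Riemann sums of periodic Lipschitz functions\<close>

lemma lipschitz_integral_step:
  fixes f :: "real \<Rightarrow> real"
  assumes lip: "\<And>x y. \<bar>f x - f y\<bar> \<le> L * \<bar>x - y\<bar>" and "d \<ge> 0" and "L \<ge> 0"
    and int: "f integrable_on {a..a + d}"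
  shows "\<bar>integral {a..a + d} f - d * f a\<bar> \<le> L * d\<^sup>2"
proof -
  have "((\<lambda>x. f x - f a) has_integral (integral {a..a + d} f - d * f a)) {a..a + d}"
    using has_integral_diff[OF integrable_integral[OF int] has_integral_const_real[of "f a" a "a + d"]]
      \<open>d \<ge> 0\<close> by simp
  then have "norm (integral {a..a + d} f - d * f a) \<le> (L * d) * measure lborel {a..a + d}"
  proof (rule has_integral_bound_real[where S = "{}", rotated 2])
    fix x assume x: "x \<in> {a..a + d} - {}"
    have "\<bar>f x - f a\<bar> \<le> L * \<bar>x - a\<bar>" by (rule lip)
    also have "\<dots> \<le> L * d" using x \<open>L \<ge> 0\<close> by (intro mult_left_mono) auto
    finally show "norm (f x - f a) \<le> L * d" by simp
  qed (use assms in auto)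
  with \<open>d \<ge> 0\<close> show ?thesis by (simp add: power2_eq_square)
qed

lemma lipschitz_integral_sum:
  fixes f :: "real \<Rightarrow> real"
  assumes lip: "\<And>x y. \<bar>f x - f y\<bar> \<le> L * \<bar>x - y\<bar>" and "d \<ge> 0" and "L \<ge> 0"
    and cont: "continuous_on UNIV f"
  shows "\<bar>integral {a..a + d * real n} f - d * (\<Sum>j<n. f (a + d * real j))\<bar> \<le> real n * (L * d\<^sup>2)"
proof (induction n)
  case (Suc n)
  have int: "f integrable_on {u..v}" for u v
    by (intro integrable_continuous_real continuous_on_subset[OF cont]) auto
  define b where "b = a + d * real n"
  have "integral {a..b} f + integral {b..b + d} f = integral {a..b + d} f"
    by (rule Henstock_Kurzweil_Integration.integral_combine) (use \<open>d \<ge> 0\<close> in \<open>auto simp: b_def int\<close>)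
  moreover have "\<bar>integral {b..b + d} f - d * f b\<bar> \<le> L * d\<^sup>2"
    by (rule lipschitz_integral_step) (use assms int in auto)
  moreover have "b + d = a + d * real (Suc n)" by (simp add: b_def algebra_simps)
  ultimately show ?case using Suc by (simp add: b_def algebra_simps abs_le_iff)
qed simp

text \<open>The error is uniform in the offset \<open>b\<close>, because the polygons used later are
  rotated by angles over which there is no control. Half of the constant \<open>4 * pi * L\<close>
  pays for moving the first node close to \<open>-pi\<close>, the other half for the Riemann sum
  that starts at \<open>-pi\<close>.\<close>

lemma periodic_node_mean:
  fixes f :: "real \<Rightarrow> real"
  assumes lip: "\<And>x y. \<bar>f x - f y\<bar> \<le> L * \<bar>x - y\<bar>" and "L \<ge> 0"
    and per: "\<And>x. f (x + 2 * pi) = f x" and "N > 0"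
  shows "\<bar>(\<Sum>j<N. f (b + 2 * pi * real j / real N)) / real N - integral {-pi..pi} f / (2 * pi)\<bar>
    \<le> 4 * pi * L / real N"
proof -
  define d where "d = 2 * pi / real N"
  define T where "T x = (\<Sum>j<N. f (x + d * real j))" for x
  have d: "d > 0" and dN: "d * real N = 2 * pi" using \<open>N > 0\<close> by (auto simp: d_def)
  have cont: "continuous_on UNIV f"
  proof -
    have "L-lipschitz_on UNIV f"
      by (rule lipschitz_onI) (use lip \<open>L \<ge> 0\<close> in \<open>auto simp: dist_real_def\<close>)
    then show ?thesis by (rule lipschitz_on_continuous_on)
  qed
  \<comment> \<open>A shift by one mesh width trades the node \<open>x\<close> for
    \<open>x + 2 * pi\<close>, where \<open>f\<close> has the same value.\<close>
  have T_shift: "T (x + d) = T x" for x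
  proof -
    have "T (x + d) + f x = (\<Sum>j<Suc N. f (x + d * real j))"
      by (subst sum.lessThan_Suc_shift) (simp add: T_def algebra_simps)
    also have "\<dots> = T x + f x" using per[of x] by (simp add: T_def dN)
    finally show ?thesis by simp
  qed
  interpret T: periodic_fun_simple T d
    by standard (rule T_shift)
  \<comment> \<open>Removing \<open>i\<close> whole mesh widths from \<open>b\<close> leaves the
    point \<open>-pi + e\<close> with \<open>e\<close> at most one mesh width, so each of the
    \<open>N\<close> nodes moves by at most \<open>d\<close>.\<close>
  define i where "i = \<lfloor>(b + pi) / d\<rfloor>"
  define e where "e = b + pi - of_int i * d"
  have e: "0 \<le> e" "e \<le> d"
    using d floor_divide_lower[of d "b + pi"] floor_divide_upper[of d "b + pi"]
    by (auto simp: e_def i_def algebra_simps)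
  have "T b = T ((-pi + e) + of_int i * d)" by (simp add: e_def)
  also have "\<dots> = T (-pi + e)" by (rule T.plus_of_int)
  finally have "T b - T (-pi) = (\<Sum>j<N. f (-pi + e + d * real j) - f (-pi + d * real j))"
    by (simp add: T_def sum_subtractf)
  also have "\<bar>\<dots>\<bar> \<le> (\<Sum>j<N. L * d)"
  proof (rule order_trans[OF sum_abs sum_mono])
    fix j
    have "\<bar>f (-pi + e + d * real j) - f (-pi + d * real j)\<bar> \<le> L * \<bar>e\<bar>"
      using lip[of "-pi + e + d * real j" "-pi + d * real j"] by simp
    also have "\<dots> \<le> L * d" using e \<open>L \<ge> 0\<close> by (intro mult_left_mono) auto
    finally show "\<bar>f (-pi + e + d * real j) - f (-pi + d * real j)\<bar> \<le> L * d" .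
  qed
  finally have 1: "\<bar>T b - T (-pi)\<bar> \<le> 2 * pi * L" using dN by (simp add: algebra_simps)
  have "\<bar>integral {-pi..-pi + d * real N} f - d * T (-pi)\<bar> \<le> real N * (L * d\<^sup>2)"
    unfolding T_def by (rule lipschitz_integral_sum) (use lip d \<open>L \<ge> 0\<close> cont in auto)
  also have "real N * (L * d\<^sup>2) = d * (2 * pi * L)"
    unfolding dN[symmetric] by (simp add: power2_eq_square)
  finally have "\<bar>integral {-pi..pi} f / d - T (-pi)\<bar> \<le> 2 * pi * L"
    using d by (simp add: dN abs_le_iff field_simps)
  with 1 have "\<bar>T b - integral {-pi..pi} f / d\<bar> \<le> 4 * pi * L" by (simp add: abs_le_iff)
  then have "\<bar>T b - integral {-pi..pi} f / d\<bar> / real N \<le> 4 * pi * L / real N"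
    by (rule divide_right_mono) simp
  moreover have "\<bar>T b - integral {-pi..pi} f / d\<bar> / real N
      = \<bar>T b / real N - integral {-pi..pi} f / (2 * pi)\<bar>"
    using \<open>N > 0\<close> abs_divide[of "T b - integral {-pi..pi} f / d" "real N"]
    by (simp add: d_def diff_divide_distrib)
  ultimately show ?thesis by (simp add: T_def d_def)
qed

section \<open>Truncated logarithm of a chord length and its mean\<close>

text \<open>\<open>2 * r * \<bar>cos (x / 2)\<bar>\<close> is the distance of \<open>r * cis x\<close> from \<open>-r\<close>.\<close>

definition log_chord :: "real \<Rightarrow> real \<Rightarrow> real" where
  "log_chord r x = ln (max 1 (2 * r * \<bar>cos (x / 2)\<bar>))"

text \<open>Truncation at 1 removes the singularity of the logarithm: \<open>ln (max 1 u)\<close> is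
  1-Lipschitz in \<open>u\<close>, and the chord length is \<open>r\<close>-Lipschitz because the
  factor 2 cancels against the half angle.\<close>

lemma log_chord_lipschitz:
  assumes "r > 0"
  shows "\<bar>log_chord r x - log_chord r y\<bar> \<le> r * \<bar>x - y\<bar>"
proof -
  have ln: "ln (max 1 u) - ln (max 1 v) \<le> \<bar>u - v\<bar>" for u v :: real
  proof (cases "u \<ge> v")
    case True
    have "ln (max 1 u) - ln (max 1 v) \<le> (max 1 u - max 1 v) / max 1 v"
      by (rule ln_diff_le) auto
    also have "\<dots> \<le> max 1 u - max 1 v"
      using True by (subst (2) div_by_1[symmetric], intro divide_left_mono) (auto simp: max_def)
    finally show ?thesis using True by (auto simp: max_def split: if_splits)
  next
    case False
    then have "ln (max 1 u) \<le> ln (max 1 v)" by (subst ln_le_cancel_iff) auto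
    then show ?thesis by linarith
  qed
  have "\<bar>cos a - cos b\<bar> \<le> \<bar>a - b\<bar>" for a b :: real
  proof -
    have "\<bar>cos a - cos b\<bar> = 2 * (\<bar>sin ((a + b) / 2)\<bar> * \<bar>sin ((b - a) / 2)\<bar>)"
      by (simp add: cos_diff_cos abs_mult)
    also have "\<dots> \<le> 2 * (1 * \<bar>(b - a) / 2\<bar>)"
      by (intro mult_left_mono mult_mono abs_sin_le_one abs_sin_x_le_abs_x) auto
    finally show ?thesis by simp
  qed
  from order_trans[OF abs_triangle_ineq3 this[of "x / 2" "y / 2"]]
  have "2 * \<bar>\<bar>cos (x / 2)\<bar> - \<bar>cos (y / 2)\<bar>\<bar> \<le> \<bar>x - y\<bar>"
    by (simp flip: diff_divide_distrib)
  then have "r * (2 * \<bar>\<bar>cos (x / 2)\<bar> - \<bar>cos (y / 2)\<bar>\<bar>) \<le> r * \<bar>x - y\<bar>"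
    using assms by (intro mult_left_mono) auto
  moreover have "2 * r * \<bar>cos (x / 2)\<bar> - 2 * r * \<bar>cos (y / 2)\<bar>
      = 2 * r * (\<bar>cos (x / 2)\<bar> - \<bar>cos (y / 2)\<bar>)"
    by (simp add: algebra_simps)
  then have "\<bar>2 * r * \<bar>cos (x / 2)\<bar> - 2 * r * \<bar>cos (y / 2)\<bar>\<bar>
      = r * (2 * \<bar>\<bar>cos (x / 2)\<bar> - \<bar>cos (y / 2)\<bar>\<bar>)"
    using assms by (simp only: abs_mult) simp
  ultimately show ?thesis
    using ln[of "2 * r * \<bar>cos (x / 2)\<bar>" "2 * r * \<bar>cos (y / 2)\<bar>"]
      ln[of "2 * r * \<bar>cos (y / 2)\<bar>" "2 * r * \<bar>cos (x / 2)\<bar>"]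
    by (simp add: log_chord_def abs_le_iff abs_minus_commute)
qed

lemma log_chord_periodic: "log_chord r (x + 2 * pi) = log_chord r x"
proof -
  have "cos ((x + 2 * pi) / 2) = - cos (x / 2)"
    by (simp add: add_divide_distrib)
  then show ?thesis by (simp add: log_chord_def)
qed

lemma norm_cis_add: "norm (cis a + cis b) = 2 * \<bar>cos ((a - b) / 2)\<bar>"
proof -
  have "cis a + cis b = cis ((a + b) / 2) * (cis ((a - b) / 2) + cis (- ((a - b) / 2)))"
    by (simp add: distrib_left cis_mult) (simp add: field_simps)
  also have "cis ((a - b) / 2) + cis (- ((a - b) / 2)) = complex_of_real (2 * cos ((a - b) / 2))"
    by (simp add: complex_eq_iff)
  finally show ?thesis by (simp add: norm_mult)
qed

lemma exp_log_chord:
  assumes "r > 0"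
  shows "exp (log_chord r (b - a)) = max 1 (norm (of_real r * cis b - (- of_real r * cis a)))"
proof -
  have "norm (of_real r * cis b - (- of_real r * cis a)) = norm (of_real r * (cis b + cis a))"
    by (simp add: algebra_simps)
  also have "\<dots> = 2 * r * \<bar>cos ((b - a) / 2)\<bar>"
    using assms by (simp add: norm_mult norm_cis_add)
  finally show ?thesis by (simp add: log_chord_def)
qed

text \<open>If \<open>r \<le> 1 / 2\<close>, no chord is longer than 1 and the truncated logarithm
  vanishes. Otherwise evenness reduces the integral to twice that over \<open>{0..pi}\<close>, and
  the integrand is zero beyond the angle \<open>c\<close> at which the chord has length exactly
  1.\<close>

lemma integral_log_chord:
  assumes "r > 0"
  shows "(if r \<le> 1 / 2 then 1 / r
     else 1 / r * exp (1 / pi *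
       integral {0..pi - 2 * arcsin (1 / (2 * r))} (\<lambda>x. ln (2 * r * cos (x / 2)))))
    = exp (integral {-pi..pi} (log_chord r) / (2 * pi)) / r"
proof (cases "r \<le> 1 / 2")
  case True
  have "log_chord r x = 0" for x
  proof -
    have "2 * r * \<bar>cos (x / 2)\<bar> \<le> 1 * 1"
      using True assms by (intro mult_mono) auto
    then show ?thesis by (simp add: log_chord_def)
  qed
  then have "log_chord r = (\<lambda>x. 0)" by auto
  with True show ?thesis by simp
next
  case False
  define c where "c = pi - 2 * arcsin (1 / (2 * r))"
  have q: "0 < 1 / (2 * r)" "1 / (2 * r) < 1" using False by auto
  have as: "0 < arcsin (1 / (2 * r))" "arcsin (1 / (2 * r)) < pi / 2"
    using arcsin_less_arcsin[of 0 "1 / (2 * r)"] arcsin_less_arcsin[of "1 / (2 * r)" 1] q by simp_all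
  then have c: "0 < c" "c < pi" by (auto simp: c_def)
  have cc: "cos (c / 2) = 1 / (2 * r)"
  proof -
    have "cos (c / 2) = cos (pi / 2 - arcsin (1 / (2 * r)))" by (simp add: c_def diff_divide_distrib)
    also have "\<dots> = sin (arcsin (1 / (2 * r)))" by (simp add: cos_sin_eq)
    also have "\<dots> = 1 / (2 * r)" using q by (intro sin_arcsin) linarith+
    finally show ?thesis .
  qed
  have cont: "continuous_on A (log_chord r)" for A
    unfolding log_chord_def by (intro continuous_intros) auto
  have int: "log_chord r integrable_on {a..b}" for a b
    by (intro integrable_continuous_real cont)
  have "integral {-pi..pi} (log_chord r) = integral {-pi..0} (log_chord r) + integral {0..pi} (log_chord r)"
    by (rule Henstock_Kurzweil_Integration.integral_combine[symmetric]) (auto simp: int)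
  also have "integral {-pi..0} (log_chord r) = integral {0..pi} (log_chord r)"
    using Henstock_Kurzweil_Integration.integral_reflect_real[of pi 0 "log_chord r"]
    by (simp add: log_chord_def [abs_def])
  also have "integral {0..pi} (log_chord r) = integral {0..c} (log_chord r) + integral {c..pi} (log_chord r)"
    by (rule Henstock_Kurzweil_Integration.integral_combine[symmetric]) (use c int in auto)
  also have "integral {c..pi} (log_chord r) = integral {c..pi} (\<lambda>x. 0)"
  proof (rule integral_cong)
    fix x assume x: "x \<in> {c..pi}"
    have "cos (x / 2) \<ge> 0" using x c by (intro cos_ge_zero) auto
    moreover have "cos (x / 2) \<le> cos (c / 2)" using x c by (intro cos_monotone_0_pi_le) auto
    ultimately have "2 * r * \<bar>cos (x / 2)\<bar> \<le> 2 * r * (1 / (2 * r))"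
      using assms cc by (intro mult_left_mono) auto
    also have "\<dots> = 1" using assms by simp
    finally show "log_chord r x = 0" by (simp add: log_chord_def)
  qed
  also have "integral {0..c} (log_chord r) = integral {0..c} (\<lambda>x. ln (2 * r * cos (x / 2)))"
  proof (rule integral_cong)
    fix x assume x: "x \<in> {0..c}"
    have "cos (x / 2) \<ge> cos (c / 2)" using x c by (intro cos_monotone_0_pi_le) auto
    then have ge: "cos (x / 2) \<ge> 1 / (2 * r)" by (simp add: cc)
    then have "2 * r * cos (x / 2) \<ge> 2 * r * (1 / (2 * r))"
      using assms by (intro mult_left_mono) auto
    then have "2 * r * cos (x / 2) \<ge> 1" using assms by simp
    moreover have "cos (x / 2) \<ge> 0" using ge q by linarith
    ultimately show "log_chord r x = ln (2 * r * cos (x / 2))"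
      by (simp add: log_chord_def max_def)
  qed
  finally show ?thesis using False by (simp add: c_def)
qed

section \<open>Regular polygons and the maximum modulus principle\<close>

lemma prod_roots_unity:
  fixes v t :: complex
  assumes "m > 0"
  shows "v ^ m - t ^ m = (\<Prod>k<m. v - t * cis (2 * pi * real k / real m))"
proof -
  define p :: "complex poly" where "p = monom 1 m - 1"
  have p: "poly p z = z ^ m - 1" for z by (simp add: p_def poly_monom)
  have pd: "poly (pderiv p) z = of_nat m * z ^ (m - 1)" for z
    by (simp add: p_def pderiv_diff pderiv_monom poly_monom)
  \<comment> \<open>A common zero of \<open>p\<close> and its derivative would satisfy both
    \<open>z ^ m = 1\<close> and \<open>z ^ (m - 1) = 0\<close>.\<close>
  have "rsquarefree p"
    unfolding rsquarefree_roots using assms by (auto simp: p pd power_0_left)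
  moreover have "lead_coeff p = 1"
  proof -
    have "degree p = m"
      unfolding p_def diff_conv_add_uminus using assms
      by (subst degree_add_eq_left) (auto simp: degree_monom_eq)
    then show ?thesis using assms by (simp add: p_def)
  qed
  ultimately have dec: "(\<Prod>z | z ^ m = 1. [:-z, 1:]) = p"
    using complex_poly_decompose_rsquarefree[of p] by (simp add: p)
  have unit: "z ^ m - 1 = (\<Prod>k<m. z - cis (2 * pi * real k / real m))" for z :: complex
  proof -
    have "z ^ m - 1 = (\<Prod>w | w ^ m = 1. z - w)"
      unfolding p[symmetric] dec[symmetric] poly_prod by simp
    also have "\<dots> = (\<Prod>k<m. z - cis (2 * pi * real k / real m))"
      using prod.reindex_bij_betw[OF Complex.bij_betw_roots_unity[OF assms], of "\<lambda>w. z - w"] by simp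
    finally show ?thesis .
  qed
  show ?thesis
  proof (cases "t = 0")
    case False
    have "v ^ m - t ^ m = t ^ m * ((v / t) ^ m - 1)"
      using False by (simp add: field_simps)
    also have "\<dots> = (\<Prod>k<m. t * (v / t - cis (2 * pi * real k / real m)))"
      by (simp add: unit prod.distrib)
    also have "\<dots> = (\<Prod>k<m. v - t * cis (2 * pi * real k / real m))"
      using False by (intro prod.cong) (auto simp: field_simps)
    finally show ?thesis .
  qed (use assms in simp)
qed

lemma poly_prod_linear:
  fixes w :: "'i \<Rightarrow> 'a::comm_ring_1"
  shows "poly (\<Prod>i\<in>I. [:- w i, 1:]) z = (\<Prod>i\<in>I. z - w i)"
  by (simp add: poly_prod)

lemma ex_root_on_circle:
  fixes x :: complex
  assumes "norm x = 1" "m > 0"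
  obtains a where "cis a ^ m = x"
proof
  have "cis (Arg x / real m) ^ m = cis (real m * (Arg x / real m))" by (rule Complex.DeMoivre)
  also have "real m * (Arg x / real m) = Arg x" using assms by simp
  also have "cis (Arg x) = sgn x" using assms by (intro cis_Arg) auto
  also have "sgn x = x" using assms by (simp add: sgn_eq)
  finally show "cis (Arg x / real m) ^ m = x" .
qed

text \<open>Exchanging \<open>a i - b i * x\<close> for its reflection \<open>cnj (b i) - cnj (a i) * x\<close> whenever
  \<open>norm (a i) < norm (b i)\<close> does not change moduli on the unit circle and makes the value at \<open>0\<close>
  equal to the left-hand side.\<close>

lemma prod_max_le_on_circle:
  fixes a b :: "'i \<Rightarrow> complex"
  assumes "finite I"
  obtains x where "norm x = 1" "(\<Prod>i\<in>I. max (norm (a i)) (norm (b i))) \<le> norm (\<Prod>i\<in>I. a i - b i * x)"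
proof -
  define c where "c i = (if norm (a i) \<ge> norm (b i) then a i else cnj (b i))" for i
  define d where "d i = (if norm (a i) \<ge> norm (b i) then b i else cnj (a i))" for i
  define G where "G x = (\<Prod>i\<in>I. c i - d i * x)" for x
  have Gcont: "continuous_on S G" for S
    unfolding G_def by (intro continuous_intros)
  have "\<exists>x\<in>sphere 0 1. \<forall>y\<in>sphere 0 1. norm (G y) \<le> norm (G x)"
    by (rule continuous_attains_sup) (auto intro!: continuous_intros Gcont)
  then obtain x where x: "norm x = 1" and max: "\<And>y. norm y = 1 \<Longrightarrow> norm (G y) \<le> norm (G x)"
    by auto
  have "norm (G 0) \<le> norm (G x)"
  proof (rule maximum_modulus_frontier[where f = G and \<xi> = 0 and S = "cball 0 1"])
    show "G holomorphic_on interior (cball 0 1)"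
      unfolding G_def by (intro holomorphic_intros)
  qed (use max Gcont in auto)
  also have "norm (G x) = norm (\<Prod>i\<in>I. a i - b i * x)"
    unfolding G_def prod_norm[symmetric]
  proof (rule prod.cong)
    fix i
    have xx: "cnj x * x = 1" using x by (simp add: complex_norm_square[symmetric] mult.commute)
    have "norm (cnj (b i) - cnj (a i) * x) = norm (cnj (cnj (b i) - cnj (a i) * x))"
      by (simp only: complex_mod_cnj)
    also have "\<dots> = norm (b i - a i * cnj x) * norm x" using x by simp
    also have "\<dots> = norm (b i * x - a i * (cnj x * x))"
      by (simp add: norm_mult[symmetric] algebra_simps)
    also have "\<dots> = norm (a i - b i * x)" by (simp add: xx norm_minus_commute)
    finally show "norm (c i - d i * x) = norm (a i - b i * x)" by (simp add: c_def d_def)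
  qed simp
  also have "norm (G 0) = (\<Prod>i\<in>I. max (norm (a i)) (norm (b i)))"
    unfolding G_def prod_norm[symmetric] by (intro prod.cong) (auto simp: c_def max_def)
  finally show ?thesis using x that by blast
qed

section \<open>Sup norms on a disc and the Bernstein-Walsh inequality\<close>

lemma norm_poly_le_sup_norm:
  assumes "compact E" "z \<in> E"
  shows "norm (poly p z) \<le> sup_norm_on E (poly p)"
proof -
  have "compact ((\<lambda>z. norm (poly p z)) ` E)"
    using assms by (intro compact_continuous_image continuous_intros)
  then have "bdd_above ((\<lambda>z. norm (poly p z)) ` E)"
    by (intro bounded_imp_bdd_above compact_imp_bounded)
  then show ?thesis unfolding sup_norm_on_def using assms by (intro cSUP_upper) auto
qed

text \<open>The maximum modulus principle places a maximum on the circle. The point is written with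
  a minus sign to fit \<open>exp_log_chord\<close>, where distances are taken from
  \<open>- of_real r * cis a\<close>.\<close>

lemma sup_norm_cball_attained:
  assumes "r > 0"
  obtains a where "sup_norm_on (cball 0 r) (poly p) = norm (poly p (- of_real r * cis a))"
proof -
  have "\<exists>x\<in>sphere 0 r. \<forall>y\<in>sphere 0 r. norm (poly p y) \<le> norm (poly p x)"
    using assms by (intro continuous_attains_sup continuous_intros) auto
  then obtain x where x: "norm x = r" and max: "\<And>y. norm y = r \<Longrightarrow> norm (poly p y) \<le> norm (poly p x)"
    by auto
  have "norm (poly p z) \<le> norm (poly p x)" if "z \<in> cball 0 r" for z
    by (rule maximum_modulus_frontier[where f = "poly p" and \<xi> = z and S = "cball 0 r"])
      (use that max in \<open>auto intro!: holomorphic_intros continuous_intros\<close>)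
  then have "sup_norm_on (cball 0 r) (poly p) \<le> norm (poly p x)"
    unfolding sup_norm_on_def using assms by (intro cSUP_least) auto
  moreover have "norm (poly p x) \<le> sup_norm_on (cball 0 r) (poly p)"
    using x by (intro norm_poly_le_sup_norm) auto
  moreover have "x = - of_real r * cis (Arg (-x))"
  proof -
    have "cis (Arg (-x)) = sgn (-x)" using x assms by (intro cis_Arg) auto
    then show ?thesis using x assms by (simp add: sgn_div_norm scaleR_conv_of_real field_simps)
  qed
  ultimately show ?thesis using that by (metis order_antisym)
qed

lemma sup_norm_cball_pos:
  assumes "r > 0" "p \<noteq> 0"
  shows "sup_norm_on (cball 0 r) (poly p) > 0"
proof (rule ccontr)
  assume "\<not> ?thesis"
  then have "poly p z = 0" if "z \<in> cball 0 r" for z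
    using norm_poly_le_sup_norm[of "cball 0 r" z p] that
    by (metis compact_cball norm_le_zero_iff not_less order_trans)
  then have "cball 0 r \<subseteq> {z. poly p z = 0}" by blast
  then have "finite (cball (0::complex) r)"
    using poly_roots_finite[OF \<open>p \<noteq> 0\<close>] finite_subset by blast
  then show False using assms using uncountable_cball[of r 0] countable_finite by blast
qed

text \<open>Outside the disc, inversion helps: the reflected polynomial takes the value
  \<open>p s / s ^ degree p\<close> at \<open>inverse s\<close>, a point of the disc of radius
  \<open>1 / r\<close>, and its boundary values there are controlled by those of \<open>p\<close> on
  the circle of radius \<open>r\<close>.\<close>

lemma bernstein_walsh_disc:
  assumes "r > 0"
  shows "norm (poly p s) \<le> sup_norm_on (cball 0 r) (poly p) * (max r (norm s) / r) ^ degree p"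
proof (cases "norm s \<le> r")
  case True
  then show ?thesis using assms by (simp add: norm_poly_le_sup_norm)
next
  case False
  then have s: "s \<noteq> 0" "norm s > r" using assms by auto
  define M where "M = sup_norm_on (cball 0 r) (poly p)"
  have bd: "norm (poly (reflect_poly p) z) \<le> M / r ^ degree p" if z: "norm z = 1 / r" for z
  proof -
    have "z \<noteq> 0" using z assms by auto
    then have "norm (poly (reflect_poly p) z) = (1 / r) ^ degree p * norm (poly p (inverse z))"
      by (simp add: poly_reflect_poly_nz norm_mult norm_power z)
    also have "\<dots> \<le> (1 / r) ^ degree p * M"
      unfolding M_def using assms z
      by (intro mult_left_mono norm_poly_le_sup_norm) (auto simp: norm_inverse)
    finally show ?thesis by (simp add: power_divide)
  qed
  have "norm (poly (reflect_poly p) (inverse s)) \<le> M / r ^ degree p"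
  proof (rule maximum_modulus_frontier[where f = "poly (reflect_poly p)" and \<xi> = "inverse s"
      and S = "cball 0 (1 / r)"])
    show "inverse s \<in> cball 0 (1 / r)"
      using s assms by (simp add: norm_inverse inverse_eq_divide norm_divide frac_le)
    show "norm (poly (reflect_poly p) z) \<le> M / r ^ degree p" if "z \<in> frontier (cball 0 (1 / r))" for z
      using that assms by (intro bd) auto
  qed (auto intro!: holomorphic_intros continuous_intros)
  moreover have "norm (poly (reflect_poly p) (inverse s)) = norm (poly p s) / norm s ^ degree p"
    using s by (simp add: poly_reflect_poly_nz norm_mult norm_power norm_inverse power_inverse divide_inverse)
  ultimately have "norm (poly p s) \<le> M / r ^ degree p * norm s ^ degree p"
    using s by (simp add: divide_le_eq)
  then show ?thesis using s by (simp add: M_def power_divide max_def)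
qed

section \<open>Errors that vanish as the number of vertices grows\<close>

lemma le_of_le_add_over_nat:
  fixes x y c :: real
  assumes "\<And>m::nat. m > 0 \<Longrightarrow> x \<le> y + c / real m"
  shows "x \<le> y"
proof -
  have "(\<lambda>m. y + c / real m) \<longlonglongrightarrow> y + 0"
    by (intro tendsto_intros lim_const_over_n)
  then have "x \<le> y + 0"
    by (rule LIMSEQ_le_const) (use assms in \<open>auto intro!: exI[of _ 1]\<close>)
  then show ?thesis by simp
qed

text \<open>Stated for the sum instead of the mean, so that the error is bounded independently of
  \<open>N\<close>.\<close>

lemma log_chord_node_mean:
  assumes "r > 0" "N > 0"
  shows "\<bar>(\<Sum>l<N. log_chord r (b + 2 * pi * real l / real N))
    - real N * (integral {-pi..pi} (log_chord r) / (2 * pi))\<bar> \<le> 4 * pi * r"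
proof -
  define S where "S = (\<Sum>l<N. log_chord r (b + 2 * pi * real l / real N))"
  define J where "J = integral {-pi..pi} (log_chord r) / (2 * pi)"
  have "\<bar>S / real N - J\<bar> \<le> 4 * pi * r / real N"
    unfolding S_def J_def
    by (rule periodic_node_mean)
      (use assms log_chord_lipschitz log_chord_periodic in auto)
  then have "real N * \<bar>S / real N - J\<bar> \<le> 4 * pi * r"
    using assms by (simp add: field_simps)
  moreover have "real N * \<bar>S / real N - J\<bar> = \<bar>S - real N * J\<bar>"
  proof -
    have "real N * \<bar>S / real N - J\<bar> = \<bar>real N * (S / real N - J)\<bar>" by (simp add: abs_mult)
    also have "real N * (S / real N - J) = S - real N * J" using assms by (simp add: field_simps)
    finally show ?thesis .
  qed
  ultimately show ?thesis by (simp add: S_def J_def)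
qed

section \<open>The upper bound\<close>

text \<open>Discrete Jensen formula on the unit circle about \<open>z\<close>, followed by
  Bernstein-Walsh. The \<open>s k\<close> are the vertices of a regular \<open>m\<close>-gon on that
  circle; the second property, which encodes this, is all that is used of them later besides the
  estimate.\<close>

lemma prod_max_roots_le:
  fixes root :: "'i \<Rightarrow> complex"
  assumes "finite I" "r > 0" "m > 0"
  obtains s :: "nat \<Rightarrow> complex" and x where "norm x = 1"
    "\<And>v. (\<Prod>k<m. v - s k) = (v - z) ^ m - x"
    "(\<Prod>i\<in>I. max 1 (norm (z - root i))) ^ m
      \<le> sup_norm_on (cball 0 r) (poly (\<Prod>i\<in>I. [:-root i, 1:])) ^ m
        * ((\<Prod>k<m. max r (norm (s k))) / r ^ m) ^ card I"
proof -
  define p where "p = (\<Prod>i\<in>I. [:-root i, 1:])"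
  have deg: "degree p = card I"
    unfolding p_def by (subst degree_prod_eq_sum_degree) auto
  obtain x where x: "norm x = 1" and le: "(\<Prod>i\<in>I. max (norm ((root i - z) ^ m)) (norm (1::complex)))
      \<le> norm (\<Prod>i\<in>I. (root i - z) ^ m - 1 * x)"
    by (rule prod_max_le_on_circle[OF \<open>finite I\<close>])
  obtain t where t: "cis t ^ m = x" using ex_root_on_circle[OF x \<open>m > 0\<close>] .
  define s where "s k = z + cis t * cis (2 * pi * real k / real m)" for k
  have s: "(\<Prod>k<m. v - s k) = (v - z) ^ m - x" for v
    unfolding t[symmetric] prod_roots_unity[OF \<open>m > 0\<close>] s_def by (simp add: algebra_simps)
  have "(\<Prod>i\<in>I. max 1 (norm (z - root i))) ^ m
      = (\<Prod>i\<in>I. max (norm ((root i - z) ^ m)) (norm (1::complex)))"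
    unfolding prod_power_distrib
  proof (rule prod.cong)
    fix i
    have "max 1 y ^ m = max (y ^ m) 1" if "y \<ge> 0" for y :: real
      using that by (cases "y \<le> 1") (auto simp: max_def power_le_one antisym_conv)
    then show "max 1 (norm (z - root i)) ^ m = max (norm ((root i - z) ^ m)) (norm (1::complex))"
      by (simp add: norm_power norm_minus_commute)
  qed simp
  also have "\<dots> \<le> norm (\<Prod>i\<in>I. \<Prod>k<m. root i - s k)"
    using le by (simp add: s)
  \<comment> \<open>Exchanging the products groups the differences by vertex, which gives the values
    of \<open>p\<close> at the vertices.\<close>
  also have "\<dots> = (\<Prod>k<m. norm (poly p (s k)))"
    unfolding p_def poly_prod prod_norm[symmetric]
    by (subst prod.swap) (simp add: norm_minus_commute)
  also have "\<dots> \<le> (\<Prod>k<m. sup_norm_on (cball 0 r) (poly p) * (max r (norm (s k)) / r) ^ card I)"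
    unfolding deg[symmetric] by (intro prod_mono conjI bernstein_walsh_disc) (use assms in auto)
  also have "\<dots> = sup_norm_on (cball 0 r) (poly p) ^ m * ((\<Prod>k<m. max r (norm (s k))) / r ^ m) ^ card I"
    by (simp add: prod.distrib prod_dividef flip: prod_power_distrib)
  finally show ?thesis using that[OF x s] by (simp add: p_def)
qed

text \<open>Discrete Jensen formula on the circle of radius \<open>r\<close>:
  \<open>prod_max_le_on_circle\<close> is applied to \<open>s k ^ N\<close> and
  \<open>r ^ N\<close>, and an \<open>N\<close>-th root of the resulting unimodular \<open>x\<close>
  rotates the \<open>N\<close>-gon. The exchange of products leaves one factor per node.\<close>

lemma prod_max_nodes_le:
  fixes s :: "nat \<Rightarrow> complex"
  assumes "N > 0" "r > 0"
  obtains u where "(\<Prod>k<m. max r (norm (s k))) ^ N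
    \<le> (\<Prod>l<N. norm (\<Prod>k<m. of_real r * cis (u + 2 * pi * real l / real N) - s k))"
proof -
  obtain x where x: "norm x = 1"
    and le: "(\<Prod>k<m. max (norm (s k ^ N)) (norm (complex_of_real r ^ N)))
      \<le> norm (\<Prod>k<m. s k ^ N - of_real r ^ N * x)"
    by (rule prod_max_le_on_circle[OF finite_lessThan])
  obtain u where u: "cis u ^ N = x" using ex_root_on_circle[OF x \<open>N > 0\<close>] .
  have "max r y ^ N = max (y ^ N) (r ^ N)" if "y \<ge> 0" for y
    using that assms by (cases "y \<le> r") (auto simp: max_def power_mono antisym_conv)
  then have "(\<Prod>k<m. max r (norm (s k))) ^ N
      = (\<Prod>k<m. max (norm (s k ^ N)) (norm (complex_of_real r ^ N)))"
    using assms by (simp add: norm_power prod_power_distrib)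
  also have "\<dots> \<le> norm (\<Prod>k<m. s k ^ N - (of_real r * cis u) ^ N)"
    using le by (simp add: u power_mult_distrib)
  also have "\<dots> = (\<Prod>l<N. norm (\<Prod>k<m. of_real r * cis (u + 2 * pi * real l / real N) - s k))"
    unfolding prod_roots_unity[OF \<open>N > 0\<close>] prod_norm[symmetric]
    by (subst prod.swap) (simp add: norm_minus_commute cis_mult mult.assoc)
  finally show ?thesis using that by blast
qed

text \<open>Both polygons get the same number \<open>m\<close> of vertices, so that an
  \<open>m\<close>-th root can be taken in the estimate of \<open>W\<close>. In logarithmic form all
  losses amount to a multiple of \<open>ln 2 + 4 * pi * r\<close> that does not depend on
  \<open>m\<close>; it disappears after division by \<open>m\<close>.\<close>

lemma prod_max_roots_bound:
  fixes root :: "'i \<Rightarrow> complex"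
  assumes "finite I" "r > 0"
  shows "(\<Prod>i\<in>I. max 1 (norm (- of_real r * cis a - root i)))
    \<le> (exp (integral {-pi..pi} (log_chord r) / (2 * pi)) / r) ^ card I
      * sup_norm_on (cball 0 r) (poly (\<Prod>i\<in>I. [:-root i, 1:]))"
proof -
  define z where "z = - of_real r * cis a"
  define J where "J = integral {-pi..pi} (log_chord r) / (2 * pi)"
  define P where "P = (\<Prod>i\<in>I. max 1 (norm (z - root i)))"
  define M where "M = sup_norm_on (cball 0 r) (poly (\<Prod>i\<in>I. [:-root i, 1:]))"
  define n where "n = card I"
  have P: "P > 0" unfolding P_def by (intro prod_pos) auto
  have M: "M > 0" unfolding M_def using assms by (intro sup_norm_cball_pos) auto
  have "ln P \<le> ln M + real n * (J - ln r)"
  proof (rule le_of_le_add_over_nat)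
    fix m :: nat assume m: "m > 0"
    obtain s x where x: "norm x = 1" and s: "\<And>v. (\<Prod>k<m. v - s k) = (v - z) ^ m - x"
      and Ps: "P ^ m \<le> M ^ m * ((\<Prod>k<m. max r (norm (s k))) / r ^ m) ^ n"
      unfolding P_def M_def n_def using prod_max_roots_le[OF assms m] by metis
    define W where "W = (\<Prod>k<m. max r (norm (s k)))"
    have W: "W > 0" unfolding W_def using assms by (intro prod_pos) auto
    obtain u where u: "W ^ m \<le> (\<Prod>l<m. norm (\<Prod>k<m. of_real r * cis (u + 2 * pi * real l / real m) - s k))"
      unfolding W_def using prod_max_nodes_le[OF m \<open>r > 0\<close>] by metis
    define S where "S = (\<Sum>l<m. log_chord r (u - a + 2 * pi * real l / real m))"
    have "W ^ m \<le> (\<Prod>l<m. 2 * exp (log_chord r (u - a + 2 * pi * real l / real m)) ^ m)"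
    proof (rule order_trans[OF u], rule prod_mono, rule conjI)
      fix l
      define v where "v = of_real r * cis (u + 2 * pi * real l / real m) - z"
      \<comment> \<open>By the property of the \<open>s k\<close>, the product over \<open>k\<close>
        at this node is \<open>v ^ m - x\<close>. Doubling the larger summand costs a factor 2 per
        node, hence only 2 in total after the \<open>m\<close>-th root.\<close>
      have "norm (v ^ m - x) \<le> norm v ^ m + 1"
        using norm_triangle_ineq4[of "v ^ m" x] x by (simp add: norm_power)
      also have "\<dots> \<le> max 1 (norm v) ^ m + max 1 (norm v) ^ m"
        by (intro add_mono power_mono one_le_power) auto
      also have "max 1 (norm v) = exp (log_chord r (u - a + 2 * pi * real l / real m))"
        using exp_log_chord[OF \<open>r > 0\<close>, of "u + 2 * pi * real l / real m" a]
        by (simp add: v_def z_def algebra_simps)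
      finally show "norm (\<Prod>k<m. of_real r * cis (u + 2 * pi * real l / real m) - s k)
          \<le> 2 * exp (log_chord r (u - a + 2 * pi * real l / real m)) ^ m"
        by (simp add: s v_def)
    qed simp
    also have "\<dots> = 2 ^ m * exp S ^ m"
      by (simp add: prod.distrib prod_power_distrib S_def exp_sum)
    finally have "W ^ m \<le> (2 * exp S) ^ m" by (simp add: power_mult_distrib)
    then have "W \<le> 2 * exp S"
      using m by (subst (asm) power_mono_iff) (use W in auto)
    then have "ln W \<le> ln (2 * exp S)" using W by (subst ln_le_cancel_iff) auto
    also have "\<dots> = ln 2 + S" by (simp add: ln_mult)
    also have "S \<le> real m * J + 4 * pi * r"
      using log_chord_node_mean[OF \<open>r > 0\<close> m, of "u - a"] by (simp add: S_def J_def abs_le_iff)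
    finally have lnW: "ln W \<le> real m * J + (ln 2 + 4 * pi * r)" by simp
    have "ln (P ^ m) \<le> ln (M ^ m * (W / r ^ m) ^ n)"
      using Ps P M W \<open>r > 0\<close> by (subst ln_le_cancel_iff) (auto simp: W_def)
    also have "\<dots> = real m * ln M + real n * (ln W - real m * ln r)"
      using M W \<open>r > 0\<close> by (simp add: ln_mult ln_realpow ln_div)
    also have "\<dots> \<le> real m * ln M + real n * (real m * J + (ln 2 + 4 * pi * r) - real m * ln r)"
      using lnW by (intro add_mono mult_left_mono) auto
    finally have "real m * ln P
        \<le> real m * (ln M + real n * (J - ln r)) + real n * (ln 2 + 4 * pi * r)"
      using P by (simp add: ln_realpow algebra_simps)
    also have "\<dots> = real m * (ln M + real n * (J - ln r) + real n * (ln 2 + 4 * pi * r) / real m)"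
      using m by (simp only: distrib_left) simp
    finally have "real m * ln P
        \<le> real m * (ln M + real n * (J - ln r) + real n * (ln 2 + 4 * pi * r) / real m)" .
    then show "ln P \<le> ln M + real n * (J - ln r) + real n * (ln 2 + 4 * pi * r) / real m"
      using m by (subst (asm) mult_le_cancel_left_pos) auto
  qed
  also have "\<dots> = ln (M * (exp J / r) ^ n)"
    using M assms by (simp add: ln_mult ln_realpow ln_div)
  finally have "P \<le> M * (exp J / r) ^ n"
    using P M assms by (subst (asm) ln_le_cancel_iff) auto
  then show ?thesis by (simp add: P_def M_def J_def n_def z_def mult.commute)
qed

lemma factor_const_disc:
  assumes "r > 0"
  shows "factor_const (cball 0 r) (exp (integral {-pi..pi} (log_chord r) / (2 * pi)) / r)"
  unfolding factor_const_def
proof (intro allI impI)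
  fix n p q
  assume "1 \<le> n" and *: "lead_coeff p = 1 \<and> degree p = n \<and> monic_factor q p"
  then obtain s where q: "lead_coeff q = 1" and s: "lead_coeff s = 1" and p: "p = q * s"
    by (auto simp: monic_factor_def)
  obtain rq where "smult (lead_coeff q) (\<Prod>i<degree q. [:-rq i, 1:]) = q"
    by (rule complex_poly_decompose')
  with q have rq: "(\<Prod>i<degree q. [:-rq i, 1:]) = q" by simp
  obtain rs where "smult (lead_coeff s) (\<Prod>i<degree s. [:-rs i, 1:]) = s"
    by (rule complex_poly_decompose')
  with s have rs: "(\<Prod>i<degree s. [:-rs i, 1:]) = s" by simp
  \<comment> \<open>The disjoint sum of index sets counts the zeros of \<open>p\<close> with
    multiplicity and remembers which belong to \<open>q\<close>.\<close>
  define I where "I = {..<degree q} <+> {..<degree s}"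
  define root where "root = case_sum rq rs"
  have "finite I" by (simp add: I_def)
  have pI: "(\<Prod>i\<in>I. [:-root i, 1:]) = p"
    by (simp add: I_def root_def prod.Plus comp_def rq rs p)
  have "q \<noteq> 0" "s \<noteq> 0" using q s by auto
  then have card: "card I = n" using * by (simp add: I_def card_Plus p degree_mult_eq)
  obtain a where a: "sup_norm_on (cball 0 r) (poly q) = norm (poly q (- of_real r * cis a))"
    using sup_norm_cball_attained[OF assms] .
  define g where "g i = norm (- of_real r * cis a - root i)" for i
  have "norm (poly q (- of_real r * cis a)) = (\<Prod>i<degree q. g (Inl i))"
    by (subst rq[symmetric]) (simp only: poly_prod_linear flip: prod_norm, simp add: g_def root_def)
  also have "\<dots> \<le> (\<Prod>i<degree q. max 1 (g (Inl i)))"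
    by (intro prod_mono) (auto simp: g_def)
  \<comment> \<open>Thanks to the maximum with 1, the zeros of the cofactor can be included without
    decreasing the product; the resulting bound no longer depends on which factor was
    chosen.\<close>
  also have "\<dots> \<le> (\<Prod>i<degree q. max 1 (g (Inl i))) * (\<Prod>i<degree s. max 1 (g (Inr i)))"
    by (rule order_trans[OF _ mult_left_mono[OF prod_ge_1 prod_nonneg]]) (auto simp: le_max_iff_disj)
  also have "\<dots> = (\<Prod>i\<in>I. max 1 (g i))"
    by (simp add: I_def prod.Plus comp_def)
  also have "\<dots> \<le> (exp (integral {-pi..pi} (log_chord r) / (2 * pi)) / r) ^ n
      * sup_norm_on (cball 0 r) (poly p)"
    unfolding g_def pI[symmetric] card[symmetric] by (rule prod_max_roots_bound) fact+
  finally show "sup_norm_on (cball 0 r) (poly q)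
      \<le> (exp (integral {-pi..pi} (log_chord r) / (2 * pi)) / r) ^ n * sup_norm_on (cball 0 r) (poly p)"
    by (simp add: a)
qed

section \<open>Sharpness of the bound\<close>

text \<open>Testing with \<open>p = q = X\<close> rules out nonpositive \<open>C\<close>, so that
  \<open>ln (C * r)\<close> can be used below.\<close>

lemma factor_const_pos:
  assumes "factor_const (cball 0 r) C" "r > 0"
  shows "C > 0"
proof -
  define X :: "complex poly" where "X = [:0, 1:]"
  have "lead_coeff X = 1 \<and> degree X = 1 \<and> monic_factor X X"
    by (auto simp: X_def monic_factor_def intro!: exI[of _ 1])
  then have "sup_norm_on (cball 0 r) (poly X) \<le> C ^ 1 * sup_norm_on (cball 0 r) (poly X)"
    using assms(1) unfolding factor_const_def by blast
  moreover have "sup_norm_on (cball 0 r) (poly X) > 0"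
    using assms by (intro sup_norm_cball_pos) (auto simp: X_def)
  ultimately show ?thesis by simp
qed

text \<open>The extremal factor of \<open>z ^ N - r ^ N\<close> collects the zeros at distance at least \<open>1\<close>
  from \<open>-r\<close>.\<close>

lemma factor_const_disc_ge:
  assumes fc: "factor_const (cball 0 r) C" and r: "r > 0"
  shows "exp (integral {-pi..pi} (log_chord r) / (2 * pi)) / r \<le> C"
proof -
  define J where "J = integral {-pi..pi} (log_chord r) / (2 * pi)"
  have C: "C > 0" using factor_const_pos[OF fc r] .
  have "J \<le> ln (C * r)"
  proof (rule le_of_le_add_over_nat)
    fix N :: nat assume N: "N > 0"
    define w where "w l = of_real r * cis (2 * pi * real l / real N)" for l
    define S where "S = {l. l < N \<and> norm (w l - (- of_real r)) \<ge> 1}"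
    define p where "p = (\<Prod>l<N. [:- w l, 1:])"
    define q where "q = (\<Prod>l\<in>S. [:- w l, 1:])"
    have SN: "S \<subseteq> {..<N}" by (auto simp: S_def)
    have fin: "finite S" using SN finite_subset by blast
    have "lead_coeff p = 1" unfolding p_def by (simp add: lead_coeff_prod)
    moreover have "degree p = N"
      unfolding p_def by (subst degree_prod_eq_sum_degree) auto
    moreover have "monic_factor q p"
      unfolding monic_factor_def
    proof (intro conjI exI)
      show "lead_coeff q = 1" unfolding q_def by (simp add: lead_coeff_prod)
      show "lead_coeff (\<Prod>l\<in>{..<N} - S. [:- w l, 1:]) = 1" by (simp add: lead_coeff_prod)
      show "p = q * (\<Prod>l\<in>{..<N} - S. [:- w l, 1:])"
        unfolding p_def q_def using SN by (subst prod.subset_diff[of S]) (auto simp: mult.commute)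
    qed
    ultimately have le: "sup_norm_on (cball 0 r) (poly q) \<le> C ^ N * sup_norm_on (cball 0 r) (poly p)"
      using fc N unfolding factor_const_def by (simp add: Suc_le_eq)
    have "poly p z = z ^ N - of_real r ^ N" for z
      unfolding prod_roots_unity[OF N] by (simp add: p_def poly_prod w_def)
    then have "norm (poly p z) \<le> 2 * r ^ N" if "norm z \<le> r" for z
      using norm_triangle_ineq4[of "z ^ N" "of_real r ^ N"] power_mono[OF that norm_ge_zero, of N] r
      by (simp add: norm_power)
    then have pM: "sup_norm_on (cball 0 r) (poly p) \<le> 2 * r ^ N"
      unfolding sup_norm_on_def using r by (intro cSUP_least) auto
    define E where "E = (\<Sum>l<N. log_chord r (0 + 2 * pi * real l / real N))"
    have "exp E = (\<Prod>l<N. max 1 (norm (w l - (- of_real r))))"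
      using exp_log_chord[OF r, of _ 0] by (simp add: E_def exp_sum w_def)
    \<comment> \<open>Zeros outside \<open>S\<close> contribute 1 to the truncated product, and for
      those in \<open>S\<close> the truncation has no effect. So evaluating \<open>q\<close> at
      \<open>- of_real r\<close> recovers the whole node sum \<open>E\<close>.\<close>
    also have "\<dots> = (\<Prod>l\<in>S. norm (w l - (- of_real r)))"
      using SN by (intro prod.mono_neutral_cong_right) (auto simp: S_def)
    also have "\<dots> = norm (poly q (- of_real r))"
      unfolding q_def poly_prod_linear prod_norm[symmetric]
      by (simp only: norm_minus_commute[of "- of_real r"])
    also have "\<dots> \<le> sup_norm_on (cball 0 r) (poly q)"
      using r by (intro norm_poly_le_sup_norm) auto
    also have "\<dots> \<le> C ^ N * (2 * r ^ N)"
      using le pM C by (meson mult_left_mono order_trans zero_le_power less_imp_le)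
    finally have "E \<le> ln (C ^ N * (2 * r ^ N))"
      using C r by (subst ln_ge_iff) auto
    also have "\<dots> = real N * ln (C * r) + ln 2"
      using C r by (simp add: ln_mult ln_realpow algebra_simps)
    \<comment> \<open>The term \<open>ln 2\<close> comes from the bound \<open>2 * r ^ N\<close> for
      \<open>p\<close>, the term \<open>4 * pi * r\<close> from replacing \<open>E\<close> by
      \<open>real N * J\<close>; both are independent of \<open>N\<close>.\<close>
    finally have "real N * J \<le> real N * ln (C * r) + (ln 2 + 4 * pi * r)"
      using log_chord_node_mean[OF r N, of 0] by (simp add: E_def J_def abs_le_iff)
    also have "\<dots> = real N * (ln (C * r) + (ln 2 + 4 * pi * r) / real N)"
      using N by (simp only: distrib_left) simp
    finally show "J \<le> ln (C * r) + (ln 2 + 4 * pi * r) / real N"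
      using N by (subst (asm) mult_le_cancel_left_pos) auto
  qed
  then have "exp J \<le> C * r" using C r by (subst (asm) ln_ge_iff) auto
  then show ?thesis using r by (simp add: J_def field_simps)
qed

theorem corollary2p2:
  fixes r :: real
  assumes "r > 0"
  shows "best_factor_const (closure (ball 0 r))
    (if r \<le> 1 / 2 then 1 / r
     else 1 / r * exp (1 / pi *
       integral {0..pi - 2 * arcsin (1 / (2 * r))} (\<lambda>x. ln (2 * r * cos (x / 2)))))"
  unfolding integral_log_chord[OF assms] best_factor_const_def
  using assms factor_const_disc factor_const_disc_ge by (simp add: closure_ball)

end
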